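(* Let $R$ be a principal ideal domain. Then assigning to an $R$-module $A$ its rank $\mathrm{rk}(A)$ is an $(\mathbb N_\infty,+)$-valued dimension on the category $\mathrm{Mod}_R$ of $R$-modules and $R$-module homomorphisms.
   Context: $\mathbb N_\infty=\mathbb N\cup\{\infty\}$ with $\mathbb N=\{0,1,2,\dots\}$; addition extends the usual addition, with $a+\infty=\infty+a=\infty$ for all $a$; the neutral element is $0$. The rank $\mathrm{rk}(A)\in\mathbb N_\infty$ of an $R$-module $A$ is the cardinality of any maximal linearly independent subset of $A$, and $\mathrm{rk}(A)=\infty$ if there is no finite maximal linearly independent subset. $M$-valued dimension. Let $M$ be a commutative monoid, written additively, and $\mathbb X$ a category; $\pi_0(\mathbb X)$ denotes the collection of isomorphism classes of objects of $\mathbb X$. An $M$-valued dimension on $\mathbb X$ is a function $\dim:\pi_0(\mathbb X)\to M$ such that for every pullback $A\times_B C$ in $\mathbb X$ of a morphism $f:C\to B$ along a retraction (split epimorphism) $r:A\to B$, if $f$ is a retraction or $f$ is a section (split monomorphism), then $\dim(A\times_B C)+\dim(B)=\dim(A)+\dim(C)$. *)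

theory Defs
  imports
    "HOL-Algebra.Ring_Divisibility"
    "HOL-Library.Extended_Nat"
    "Jordan_Normal_Form.Missing_VectorSpace"
begin

text \<open>
  Composition is indexed by the three objects involved, so that hom-sets of different pairs of
  objects need not be disjoint: \<open>Comp X A B C g f\<close> is the composite of \<open>f\<close> from \<open>A\<close> to \<open>B\<close> with
  \<open>g\<close> from \<open>B\<close> to \<open>C\<close>.
\<close>

record ('o, 'f) cat =
  Obj :: "'o set"
  Hom :: "'o \<Rightarrow> 'o \<Rightarrow> 'f set"
  Ident :: "'o \<Rightarrow> 'f"
  Comp :: "'o \<Rightarrow> 'o \<Rightarrow> 'o \<Rightarrow> 'f \<Rightarrow> 'f \<Rightarrow> 'f"

locale category =
  fixes X :: "('o, 'f) cat"
  assumes ident_in_hom: "A \<in> Obj X \<Longrightarrow> Ident X A \<in> Hom X A A"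
    and comp_in_hom:
      "\<lbrakk>A \<in> Obj X; B \<in> Obj X; C \<in> Obj X; f \<in> Hom X A B; g \<in> Hom X B C\<rbrakk>
        \<Longrightarrow> Comp X A B C g f \<in> Hom X A C"
    and comp_ident_right:
      "\<lbrakk>A \<in> Obj X; B \<in> Obj X; f \<in> Hom X A B\<rbrakk> \<Longrightarrow> Comp X A A B f (Ident X A) = f"
    and comp_ident_left:
      "\<lbrakk>A \<in> Obj X; B \<in> Obj X; f \<in> Hom X A B\<rbrakk> \<Longrightarrow> Comp X A B B (Ident X B) f = f"
    and comp_assoc:
      "\<lbrakk>A \<in> Obj X; B \<in> Obj X; C \<in> Obj X; D \<in> Obj X;
        f \<in> Hom X A B; g \<in> Hom X B C; h \<in> Hom X C D\<rbrakk>
        \<Longrightarrow> Comp X A C D h (Comp X A B C g f) = Comp X A B D (Comp X B C D h g) f"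

definition isomorphic :: "('o, 'f) cat \<Rightarrow> 'o \<Rightarrow> 'o \<Rightarrow> bool" where
  "isomorphic X A B \<longleftrightarrow>
    (\<exists>f \<in> Hom X A B. \<exists>g \<in> Hom X B A.
      Comp X A B A g f = Ident X A \<and> Comp X B A B f g = Ident X B)"

definition is_retraction :: "('o, 'f) cat \<Rightarrow> 'o \<Rightarrow> 'o \<Rightarrow> 'f \<Rightarrow> bool" where
  "is_retraction X A B r \<longleftrightarrow>
    r \<in> Hom X A B \<and> (\<exists>s \<in> Hom X B A. Comp X B A B r s = Ident X B)"

definition is_section :: "('o, 'f) cat \<Rightarrow> 'o \<Rightarrow> 'o \<Rightarrow> 'f \<Rightarrow> bool" where
  "is_section X A B s \<longleftrightarrow>
    s \<in> Hom X A B \<and> (\<exists>r \<in> Hom X B A. Comp X A B A r s = Ident X A)"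

text \<open>
  \<open>is_pullback X A B C r f P p q\<close>: the object \<open>P\<close> with projections \<open>p\<close> to \<open>A\<close> and \<open>q\<close> to \<open>C\<close> is a
  pullback of \<open>r\<close> from \<open>A\<close> to \<open>B\<close> and \<open>f\<close> from \<open>C\<close> to \<open>B\<close>.
\<close>

definition is_pullback ::
    "('o, 'f) cat \<Rightarrow> 'o \<Rightarrow> 'o \<Rightarrow> 'o \<Rightarrow> 'f \<Rightarrow> 'f \<Rightarrow> 'o \<Rightarrow> 'f \<Rightarrow> 'f \<Rightarrow> bool" where
  "is_pullback X A B C r f P p q \<longleftrightarrow>
    r \<in> Hom X A B \<and> f \<in> Hom X C B \<and>
    P \<in> Obj X \<and> p \<in> Hom X P A \<and> q \<in> Hom X P C \<and>
    Comp X P A B r p = Comp X P C B f q \<and>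
    (\<forall>T \<in> Obj X. \<forall>a \<in> Hom X T A. \<forall>c \<in> Hom X T C.
      Comp X T A B r a = Comp X T C B f c \<longrightarrow>
      (\<exists>!u. u \<in> Hom X T P \<and> Comp X T P A p u = a \<and> Comp X T P C q u = c))"

text \<open>
  A function on the isomorphism classes of objects is given by a function \<open>d\<close> on objects that is
  constant on isomorphism classes.
\<close>

locale valued_dimension = category X
  for X :: "('o, 'f) cat" +
  fixes d :: "'o \<Rightarrow> 'v :: comm_monoid_add"
  assumes dim_iso_invariant:
      "\<lbrakk>A \<in> Obj X; B \<in> Obj X; isomorphic X A B\<rbrakk> \<Longrightarrow> d A = d B"
    and dim_pullback:
      "\<lbrakk>A \<in> Obj X; B \<in> Obj X; C \<in> Obj X; is_retraction X A B r;
        is_retraction X C B f \<or> is_section X C B f; is_pullback X A B C r f P p q\<rbrakk>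
        \<Longrightarrow> d P + d B = d A + d C"

text \<open>
  The type \<open>'m\<close> plays the role of the universe: the objects are all \<open>R\<close>-modules whose carrier is
  a set of elements of \<open>'m\<close>. Homomorphisms are taken to be \<open>undefined\<close> outside the carrier, so
  that equality of morphisms is equality on the carrier. The ring multiplication and unit which
  the record type \<open>module\<close> inherits from \<open>ring\<close> are unconstrained and ignored by the morphisms.
\<close>

definition Mod_cat ::
    "('a, 'r) ring_scheme \<Rightarrow> (('a, 'm) module, 'm \<Rightarrow> 'm) cat" where
  "Mod_cat R =
    \<lparr>Obj = {M. module R M},
     Hom = (\<lambda>A B. module_hom R A B \<inter> extensional (carrier A)),
     Ident = (\<lambda>A. \<lambda>x \<in> carrier A. x),
     Comp = (\<lambda>A B C g f. compose (carrier A) g f)\<rparr>"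

definition max_lin_indpt ::
    "('a, 'r) ring_scheme \<Rightarrow> ('a, 'm, 's) module_scheme \<Rightarrow> 'm set \<Rightarrow> bool" where
  "max_lin_indpt R A S \<longleftrightarrow> maximal S (\<lambda>T. T \<subseteq> carrier A \<and> \<not> module.lin_dep R A T)"

definition rk ::
    "('a, 'r) ring_scheme \<Rightarrow> ('a, 'm, 's) module_scheme \<Rightarrow> enat" where
  "rk R A =
    (if \<exists>S. finite S \<and> max_lin_indpt R A S
     then enat (THE n. \<exists>S. finite S \<and> max_lin_indpt R A S \<and> card S = n)
     else \<infinity>)"

end

theory Submission
  imports Defs
begin

text \<open>
  Over a domain, the elements having a nonzero multiple in the span of \<open>S\<close> form a closure operator
  with the exchange property, so the rank is the dimension of a matroid, and it is additive along
  surjective homomorphisms \<open>h\<close> from \<open>A\<close> to \<open>B\<close>: the rank of \<open>A\<close> is the rank of \<open>ker h\<close> plus that of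
  \<open>B\<close>. In a pullback of a retraction \<open>r\<close> from \<open>A\<close> to \<open>B\<close> along any \<open>f\<close> from \<open>C\<close> to \<open>B\<close>, the projection
  to \<open>C\<close> is surjective and its kernel is isomorphic to \<open>ker r\<close>. Adding up the two instances of
  additivity gives the dimension formula.
\<close>

section \<open>Saturated spans in a module over a domain\<close>

locale domain_module = R?: domain R + module R M for R (structure) and M (structure)
begin

text \<open>
  The trace on \<open>M\<close> of the span of \<open>S\<close> over the quotient field; it makes localization unnecessary.
\<close>

definition sat :: "'c set \<Rightarrow> 'c set" where
  "sat S = {x \<in> carrier M. \<exists>c \<in> carrier R - {\<zero>}. c \<odot>\<^bsub>M\<^esub> x \<in> span S}"

lemma submodule_carrier: "LinearCombinations.submodule R (carrier M) M"
  by unfold_locales auto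

lemma submodule_diff:
  assumes "LinearCombinations.submodule R N M" "x \<in> N" "y \<in> N"
  shows "x \<ominus>\<^bsub>M\<^esub> y \<in> N"
proof -
  interpret N: LinearCombinations.submodule R N M by fact
  have x: "x \<in> carrier M" and y: "y \<in> carrier M"
    using assms N.subset by auto
  have "\<ominus>\<^bsub>M\<^esub> y = (\<ominus> \<one>) \<odot>\<^bsub>M\<^esub> y"
    using y smult_l_minus[of \<one> y] by simp
  then show ?thesis
    using assms(2,3) by (simp add: M.minus_eq N.m_closed N.smult_closed)
qed

lemma sat_subset: "sat S \<subseteq> carrier M"
  by (auto simp: sat_def)

lemma satI:
  "\<lbrakk>x \<in> carrier M; c \<in> carrier R; c \<noteq> \<zero>; c \<odot>\<^bsub>M\<^esub> x \<in> span S\<rbrakk> \<Longrightarrow> x \<in> sat S"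
  by (auto simp: sat_def)

lemma satE:
  assumes "x \<in> sat S"
  obtains c where "x \<in> carrier M" "c \<in> carrier R" "c \<noteq> \<zero>" "c \<odot>\<^bsub>M\<^esub> x \<in> span S"
  using assms by (auto simp: sat_def)

lemma span_subset_sat: "S \<subseteq> carrier M \<Longrightarrow> span S \<subseteq> sat S"
  using span_is_subset2[of S] by (auto intro!: satI[of _ \<one>] simp: subset_iff)

lemma subset_sat: "S \<subseteq> carrier M \<Longrightarrow> S \<subseteq> sat S"
  using span_subset_sat in_own_span by blast

lemma sat_mono: "S \<subseteq> T \<Longrightarrow> sat S \<subseteq> sat T"
  using span_is_monotone[of S T] unfolding sat_def by blast

text \<open>Denominators are cleared as for fractions: if \<open>c\<close> works for
  \<open>x\<close> and \<open>d\<close> for \<open>y\<close>, then \<open>c \<otimes> d\<close>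
  works for the sum, and it is nonzero because \<open>R\<close> is a domain.\<close>

lemma submodule_sat:
  assumes S: "S \<subseteq> carrier M"
  shows "LinearCombinations.submodule R (sat S) M"
proof -
  interpret N: LinearCombinations.submodule R "span S" M
    using S by (rule span_is_submodule)
  show ?thesis
  proof
    show "sat S \<subseteq> carrier M" by (rule sat_subset)
    show "\<zero>\<^bsub>M\<^esub> \<in> sat S"
      by (rule satI[of _ \<one>]) auto
  next
    fix c x assume c: "c \<in> carrier R" and "x \<in> sat S"
    then obtain d where d: "x \<in> carrier M" "d \<in> carrier R" "d \<noteq> \<zero>" "d \<odot>\<^bsub>M\<^esub> x \<in> span S"
      by (auto elim: satE)
    have "d \<odot>\<^bsub>M\<^esub> (c \<odot>\<^bsub>M\<^esub> x) = c \<odot>\<^bsub>M\<^esub> (d \<odot>\<^bsub>M\<^esub> x)"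
      using c d by (simp add: smult_assoc1[symmetric] R.m_comm)
    then show "c \<odot>\<^bsub>M\<^esub> x \<in> sat S"
      using c d by (intro satI[of _ d]) auto
  next
    fix x y assume "x \<in> sat S" "y \<in> sat S"
    then obtain c d where c: "x \<in> carrier M" "c \<in> carrier R" "c \<noteq> \<zero>" "c \<odot>\<^bsub>M\<^esub> x \<in> span S"
      and d: "y \<in> carrier M" "d \<in> carrier R" "d \<noteq> \<zero>" "d \<odot>\<^bsub>M\<^esub> y \<in> span S"
      by (auto elim!: satE)
    have "(c \<otimes> d) \<odot>\<^bsub>M\<^esub> (x \<oplus>\<^bsub>M\<^esub> y) = d \<odot>\<^bsub>M\<^esub> (c \<odot>\<^bsub>M\<^esub> x) \<oplus>\<^bsub>M\<^esub> c \<odot>\<^bsub>M\<^esub> (d \<odot>\<^bsub>M\<^esub> y)"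
      using c d by (simp add: smult_r_distr smult_assoc1[symmetric] R.m_comm)
    moreover have "c \<otimes> d \<noteq> \<zero>"
      using c d by (simp add: R.integral_iff)
    ultimately show "x \<oplus>\<^bsub>M\<^esub> y \<in> sat S"
      using c d by (intro satI[of _ "c \<otimes> d"]) auto
  qed
qed

lemma sat_cancel:
  assumes "S \<subseteq> carrier M" "x \<in> carrier M" "c \<in> carrier R" "c \<noteq> \<zero>" "c \<odot>\<^bsub>M\<^esub> x \<in> sat S"
  shows "x \<in> sat S"
proof -
  obtain d where d: "d \<in> carrier R" "d \<noteq> \<zero>" "d \<odot>\<^bsub>M\<^esub> (c \<odot>\<^bsub>M\<^esub> x) \<in> span S"
    using assms(5) by (auto elim: satE)
  then show ?thesis
    using assms by (intro satI[of _ "d \<otimes> c"]) (auto simp: smult_assoc1 R.integral_iff)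
qed

text \<open>As a submodule containing \<open>S\<close>, \<open>sat T\<close> contains
  \<open>span S\<close>; the denominator left over is removed by \<open>sat_cancel\<close>. This
  makes \<open>sat\<close> idempotent, hence a closure operator.\<close>

lemma sat_trans:
  assumes "T \<subseteq> carrier M" "S \<subseteq> sat T"
  shows "sat S \<subseteq> sat T"
proof
  fix x assume "x \<in> sat S"
  then obtain c where c: "x \<in> carrier M" "c \<in> carrier R" "c \<noteq> \<zero>" "c \<odot>\<^bsub>M\<^esub> x \<in> span S"
    by (auto elim: satE)
  then have "c \<odot>\<^bsub>M\<^esub> x \<in> sat T"
    using span_is_subset[OF assms(2) submodule_sat[OF assms(1)]] by blast
  then show "x \<in> sat T"
    using c assms(1) by (intro sat_cancel[of T x c]) auto
qed

text \<open>The sums of this form make up a submodule containing \<open>insert t S\<close>, so they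
  exhaust its span.\<close>

lemma span_insertE:
  assumes "S \<subseteq> carrier M" "t \<in> carrier M" "y \<in> span (insert t S)"
  obtains a w where "a \<in> carrier R" "w \<in> span S" "y = a \<odot>\<^bsub>M\<^esub> t \<oplus>\<^bsub>M\<^esub> w"
proof -
  let ?N = "{a \<odot>\<^bsub>M\<^esub> t \<oplus>\<^bsub>M\<^esub> w |a w. a \<in> carrier R \<and> w \<in> span S}"
  interpret S: LinearCombinations.submodule R "span S" M
    using assms(1) by (rule span_is_submodule)
  have cl: "w \<in> carrier M" if "w \<in> span S" for w
    using that S.subset by blast
  have "LinearCombinations.submodule R ?N M"
  proof
    show "?N \<subseteq> carrier M"
      using assms(2) cl by auto
  next
    fix x y assume "x \<in> ?N" "y \<in> ?N"
    then obtain a w b v where "a \<in> carrier R" "w \<in> span S" "x = a \<odot>\<^bsub>M\<^esub> t \<oplus>\<^bsub>M\<^esub> w"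
      and "b \<in> carrier R" "v \<in> span S" "y = b \<odot>\<^bsub>M\<^esub> t \<oplus>\<^bsub>M\<^esub> v" by blast
    moreover from this have "x \<oplus>\<^bsub>M\<^esub> y = (a \<oplus> b) \<odot>\<^bsub>M\<^esub> t \<oplus>\<^bsub>M\<^esub> (w \<oplus>\<^bsub>M\<^esub> v)"
      using assms(2) by (simp add: cl smult_l_distr M.a_ac)
    ultimately show "x \<oplus>\<^bsub>M\<^esub> y \<in> ?N"
      by blast
  next
    show "\<zero>\<^bsub>M\<^esub> \<in> ?N"
      using assms(2) by (auto intro!: exI[of _ \<zero>] exI[of _ "\<zero>\<^bsub>M\<^esub>"])
  next
    fix c x assume "c \<in> carrier R" "x \<in> ?N"
    then obtain a w where "c \<in> carrier R" "a \<in> carrier R" "w \<in> span S" "x = a \<odot>\<^bsub>M\<^esub> t \<oplus>\<^bsub>M\<^esub> w"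
      by blast
    moreover from this have "c \<odot>\<^bsub>M\<^esub> x = (c \<otimes> a) \<odot>\<^bsub>M\<^esub> t \<oplus>\<^bsub>M\<^esub> c \<odot>\<^bsub>M\<^esub> w"
      using assms(2) by (simp add: cl smult_r_distr smult_assoc1)
    ultimately show "c \<odot>\<^bsub>M\<^esub> x \<in> ?N"
      by blast
  qed
  moreover have "insert t S \<subseteq> ?N"
  proof (intro insert_subsetI subsetI)
    show "t \<in> ?N"
      using assms(2) by (auto intro!: exI[of _ \<one>] exI[of _ "\<zero>\<^bsub>M\<^esub>"])
    fix s assume "s \<in> S"
    then show "s \<in> ?N"
      using assms in_own_span[OF assms(1)] by (auto intro!: exI[of _ \<zero>] exI[of _ s])
  qed
  ultimately have "span (insert t S) \<subseteq> ?N"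
    by (intro span_is_subset)
  then show ?thesis
    using assms(3) that by blast
qed

section \<open>The exchange property and linear independence\<close>

text \<open>Some nonzero multiple of \<open>x\<close> is \<open>a\<close> times \<open>t\<close>
  plus an element of \<open>span T\<close>. Here \<open>a\<close> is nonzero, as otherwise
  \<open>x\<close> would lie in \<open>sat T\<close>; solving for the multiple of \<open>t\<close>
  expresses it over \<open>insert x T\<close>.\<close>

lemma sat_exchange:
  assumes T: "T \<subseteq> carrier M" and t: "t \<in> carrier M"
    and x: "x \<in> sat (insert t T)" "x \<notin> sat T"
  shows "t \<in> sat (insert x T)"
proof -
  obtain c where c: "x \<in> carrier M" "c \<in> carrier R" "c \<noteq> \<zero>" "c \<odot>\<^bsub>M\<^esub> x \<in> span (insert t T)"
    using x(1) by (auto elim: satE)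
  then obtain a w where a: "a \<in> carrier R" and w: "w \<in> span T"
    and eq: "c \<odot>\<^bsub>M\<^esub> x = a \<odot>\<^bsub>M\<^esub> t \<oplus>\<^bsub>M\<^esub> w"
    using span_insertE[OF T t] by metis
  have wc: "w \<in> carrier M"
    using w span_is_subset2[OF T] by blast
  have "a \<noteq> \<zero>"
    using satI[of x c T] c eq w wc t x(2) by auto
  have xT: "insert x T \<subseteq> carrier M"
    using c T by blast
  interpret S: LinearCombinations.submodule R "span (insert x T)" M
    using xT by (rule span_is_submodule)
  have "x \<in> span (insert x T)" "w \<in> span (insert x T)"
    using in_own_span[OF xT] w span_is_monotone[of T "insert x T"] by blast+
  then have "c \<odot>\<^bsub>M\<^esub> x \<ominus>\<^bsub>M\<^esub> w \<in> span (insert x T)"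
    using c by (intro submodule_diff[OF S.submodule_axioms]) auto
  moreover have "c \<odot>\<^bsub>M\<^esub> x \<ominus>\<^bsub>M\<^esub> w = a \<odot>\<^bsub>M\<^esub> t"
    using eq a t wc by (simp add: M.minus_eq M.a_assoc M.r_neg)
  ultimately show ?thesis
    using a \<open>a \<noteq> \<zero>\<close> t by (intro satI[of t a]) auto
qed

text \<open>Subtracting a nonzero multiple of \<open>x\<close> from its expression over
  \<open>S\<close> gives a relation; since \<open>x\<close> is not in \<open>S\<close>, its
  coefficient \<open>\<ominus> c\<close> cannot merge with one from \<open>S\<close> and stays
  nonzero.\<close>

lemma lin_dep_insert:
  assumes S: "S \<subseteq> carrier M" and x: "x \<in> sat S" "x \<notin> S"
  shows "lin_dep (insert x S)"
proof -
  obtain c where c: "x \<in> carrier M" "c \<in> carrier R" "c \<noteq> \<zero>" "c \<odot>\<^bsub>M\<^esub> x \<in> span S"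
    using x by (auto elim: satE)
  then obtain a A where A: "finite A" "A \<subseteq> S" "a \<in> A \<rightarrow> carrier R" "lincomb a A = c \<odot>\<^bsub>M\<^esub> x"
    by (auto simp: span_def)
  let ?a = "\<lambda>v. if v = x then \<ominus> c else a v"
  have xA: "x \<notin> A" and AM: "A \<subseteq> carrier M"
    using A x S by auto
  have "lincomb ?a A = lincomb a A"
    using A AM xA by (intro lincomb_cong) auto
  then have "lincomb ?a (A \<union> {x}) = (\<ominus> c) \<odot>\<^bsub>M\<^esub> x \<oplus>\<^bsub>M\<^esub> c \<odot>\<^bsub>M\<^esub> x"
    using A AM c xA by (subst lincomb_insert) (auto simp: Pi_iff)
  also have "\<dots> = \<zero>\<^bsub>M\<^esub>"
    using c by (simp add: smult_l_minus M.l_neg)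
  finally show ?thesis
    using A c by (intro lin_dep_crit[of "A \<union> {x}" _ ?a x]) auto
qed

text \<open>In a nontrivial relation on \<open>insert x S\<close>, a nonzero coefficient at
  \<open>x\<close> would put \<open>x\<close> into \<open>sat S\<close>, while a zero one would
  leave a nontrivial relation on \<open>S\<close>.\<close>

lemma lin_indpt_insert:
  assumes S: "S \<subseteq> carrier M" and li: "lin_indpt S" and x: "x \<in> carrier M" "x \<notin> sat S"
  shows "lin_indpt (insert x S)"
proof
  assume "lin_dep (insert x S)"
  then obtain A a v where A: "finite A" "A \<subseteq> insert x S" "a \<in> A \<rightarrow> carrier R"
    "lincomb a A = \<zero>\<^bsub>M\<^esub>" "v \<in> A" "a v \<noteq> \<zero>"
    by (auto simp: lin_dep_def)
  have AM: "A \<subseteq> carrier M"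
    using A S x by auto
  have xA: "x \<in> A"
    using A li lin_dep_crit[of A S a v] by blast
  let ?w = "lincomb a (A - {x})"
  have w: "?w \<in> carrier M" "?w \<in> span S"
    using A AM by (auto simp: span_def intro!: lincomb_closed)
  have ax: "a x \<in> carrier R"
    using A xA by auto
  have eq: "a x \<odot>\<^bsub>M\<^esub> x \<oplus>\<^bsub>M\<^esub> ?w = \<zero>\<^bsub>M\<^esub>"
    using lincomb_del2[of A a x] A AM xA by simp
  show False
  proof (cases "a x = \<zero>")
    case True
    then have "?w = \<zero>\<^bsub>M\<^esub>" "v \<in> A - {x}"
      using eq x w A by auto
    then show False
      using lin_dep_crit[of "A - {x}" S a v] A li by auto
  next
    case False
    interpret S: LinearCombinations.submodule R "span S" M
      using S by (rule span_is_submodule)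
    have "a x \<odot>\<^bsub>M\<^esub> x = \<zero>\<^bsub>M\<^esub> \<ominus>\<^bsub>M\<^esub> ?w"
      using M.minus_equality[OF eq] w x ax by (simp add: M.minus_eq)
    then have "a x \<odot>\<^bsub>M\<^esub> x \<in> span S"
      using submodule_diff[OF S.submodule_axioms S.zero_closed w(2)] by simp
    then show False
      using satI[of x "a x" S] x ax False by auto
  qed
qed

lemma lin_indpt_empty: "lin_indpt {}"
  by (auto simp: lin_dep_def)

section \<open>Steinitz exchange and transport of independent sets\<close>

text \<open>Not every \<open>t\<close> in \<open>T - S\<close> need do. One is taken from a smallest
  \<open>U\<close> between \<open>S\<close> and \<open>T\<close> whose saturation contains
  \<open>s\<close>: removing \<open>t\<close> from \<open>U\<close> loses \<open>s\<close>, so the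
  exchange property applies in \<open>U\<close>, and monotonicity passes to
  \<open>T\<close>.\<close>

lemma exchange_insert:
  assumes T: "finite T" "T \<subseteq> carrier M" and S: "S \<subseteq> T" and s: "s \<in> sat T" "s \<notin> sat S"
  obtains t where "t \<in> T - S" "t \<in> sat (insert s (T - {t}))"
proof -
  let ?P = "\<lambda>U. S \<subseteq> U \<and> U \<subseteq> T \<and> s \<in> sat U"
  have "?P T"
    using S s by blast
  from ex_has_least_nat[of ?P, OF this, of card]
  obtain U where U: "?P U" and min: "\<And>V. ?P V \<Longrightarrow> card U \<le> card V"
    by blast
  have "U \<noteq> S"
    using U s by blast
  then obtain t where t: "t \<in> U" "t \<notin> S"
    using U by blast
  have "finite U"
    using U T finite_subset by blast
  then have "card (U - {t}) < card U"
    using t by (meson card_Diff1_less)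
  then have "\<not> ?P (U - {t})"
    using min[of "U - {t}"] by linarith
  then have nin: "s \<notin> sat (U - {t})"
    using U t by blast
  have "s \<in> sat (insert t (U - {t}))"
    using U t by (simp add: insert_absorb)
  then have "t \<in> sat (insert s (U - {t}))"
    using U T t nin sat_exchange[of "U - {t}" t s] by blast
  also have "\<dots> \<subseteq> sat (insert s (T - {t}))"
    using U by (intro sat_mono) auto
  finally show ?thesis
    using that[of t] t U by blast
qed

lemma steinitz:
  assumes "finite S" "S \<subseteq> carrier M" "lin_indpt S"
    and T: "finite T" "T \<subseteq> carrier M" "S \<subseteq> sat T"
  shows "card S \<le> card T"
proof -
  \<comment> \<open>Strengthened for the induction: the elements of \<open>S\<close> are swapped
    into \<open>T\<close> one at a time, never enlarging the set or shrinking its saturation. The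
    element swapped out is never one swapped in before.\<close>
  have "\<exists>T'. finite T' \<and> T' \<subseteq> carrier M \<and> card T' \<le> card T \<and> S \<subseteq> T' \<and> sat T \<subseteq> sat T'"
    using assms(1-3,6)
  proof (induction S)
    case empty
    then show ?case
      using T by (intro exI[of _ T]) simp
  next
    case (insert s S)
    have "lin_indpt S"
      using insert.prems(2) by (rule subset_li_is_li) blast
    then obtain T' where T': "finite T'" "T' \<subseteq> carrier M" "card T' \<le> card T" "S \<subseteq> T'" "sat T \<subseteq> sat T'"
      using insert.IH insert.prems by (metis insert_subset)
    show ?case
    proof (cases "s \<in> T'")
      case True
      then show ?thesis
        using T' by blast
    next
      case False
      have "s \<notin> sat S"
        using lin_dep_insert[of S s] insert by blast
      moreover have "s \<in> sat T'"
        using T' insert by blast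
      ultimately obtain t where t: "t \<in> T' - S" "t \<in> sat (insert s (T' - {t}))"
        using exchange_insert[of T' S s] T' by blast
      let ?U = "insert s (T' - {t})"
      have UM: "?U \<subseteq> carrier M"
        using T' insert by blast
      have "T' \<subseteq> sat ?U"
        using t subset_sat[OF UM] by blast
      then have "sat T \<subseteq> sat ?U"
        using T' sat_trans[OF UM] by blast
      moreover have "card ?U \<le> card T"
        using T' t False by (metis DiffD1 card_Suc_Diff1 card_insert_disjoint finite_Diff Diff_iff)
      moreover have "S \<subseteq> ?U"
        using T' t by blast
      ultimately show ?thesis
        using UM T' by (intro exI[of _ ?U]) auto
    qed
  qed
  then show ?thesis
    by (meson card_mono le_trans)
qed

text \<open>
  With \<open>S = {}\<close> this transports independent sets along a map; with \<open>S\<close> in a kernel and \<open>f\<close> a section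
  of a surjection it glues independent sets of the kernel and of the quotient.
\<close>

lemma lin_indpt_Un_image:
  assumes N: "domain_module R N"
    and S: "finite S" "S \<subseteq> carrier M" "lin_indpt S"
    and T: "finite T" "T \<subseteq> carrier N" "\<not> module.lin_dep R N T"
    and f: "f \<in> T \<rightarrow> carrier M"
    and reflect: "\<And>X x. \<lbrakk>X \<subseteq> T; x \<in> T; f x \<in> sat (S \<union> f ` X)\<rbrakk> \<Longrightarrow> x \<in> domain_module.sat R N X"
  shows "lin_indpt (S \<union> f ` T) \<and> card (S \<union> f ` T) = card S + card T"
proof -
  interpret N: domain_module R N by fact
  show ?thesis
    using T f reflect
  proof (induction T)
    case empty
    then show ?case
      using S by simp
  next
    case (insert t T)
    have "N.lin_indpt T"
      using insert.prems(2) by (rule N.subset_li_is_li) blast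
    then have "lin_indpt (S \<union> f ` T) \<and> card (S \<union> f ` T) = card S + card T"
      using insert.prems(1,3) by (intro insert.IH insert.prems(4)) auto
    then have IH: "lin_indpt (S \<union> f ` T)" "card (S \<union> f ` T) = card S + card T"
      by blast+
    have TM: "S \<union> f ` T \<subseteq> carrier M"
      using S insert.prems(3) by auto
    have "t \<notin> N.sat T"
      using N.lin_dep_insert[of T t] insert by blast
    then have nin: "f t \<notin> sat (S \<union> f ` T)"
      using insert.prems(4)[of T t] by blast
    then have "f t \<notin> S \<union> f ` T"
      using subset_sat[OF TM] by blast
    then have "card (insert (f t) (S \<union> f ` T)) = Suc (card S + card T)"
      using IH S insert.hyps by simp
    moreover have "lin_indpt (insert (f t) (S \<union> f ` T))"
      using IH TM nin insert.prems(3) by (intro lin_indpt_insert) auto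
    ultimately show ?case
      using insert.hyps by simp
  qed
qed

lemma lin_indpt_image:
  assumes "domain_module R N" "finite T" "T \<subseteq> carrier N" "\<not> module.lin_dep R N T"
    and "f \<in> T \<rightarrow> carrier M"
    and "\<And>X x. \<lbrakk>X \<subseteq> T; x \<in> T; f x \<in> sat (f ` X)\<rbrakk> \<Longrightarrow> x \<in> domain_module.sat R N X"
  shows "lin_indpt (f ` T) \<and> card (f ` T) = card T"
  using lin_indpt_Un_image[of N "{}" T f] assms lin_indpt_empty by simp

section \<open>Rank as the supremum of sizes of independent sets\<close>

text \<open>The rank of a subset, so that kernels need not be turned into modules of their own.\<close>

definition urk :: "'c set \<Rightarrow> enat" where
  "urk N = (SUP S \<in> {S. finite S \<and> S \<subseteq> N \<and> lin_indpt S}. enat (card S))"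

lemma urk_upper: "\<lbrakk>finite S; S \<subseteq> N; lin_indpt S\<rbrakk> \<Longrightarrow> enat (card S) \<le> urk N"
  unfolding urk_def by (rule SUP_upper) simp

lemma urk_least:
  "(\<And>S. \<lbrakk>finite S; S \<subseteq> N; lin_indpt S\<rbrakk> \<Longrightarrow> enat (card S) \<le> u) \<Longrightarrow> urk N \<le> u"
  unfolding urk_def by (rule SUP_least) simp

lemma urk_eq_card:
  assumes "N \<subseteq> carrier M" "finite S" "S \<subseteq> N" "lin_indpt S" "N \<subseteq> sat S"
  shows "urk N = enat (card S)"
proof (rule antisym)
  show "urk N \<le> enat (card S)"
  proof (rule urk_least)
    fix T assume "finite T" "T \<subseteq> N" "lin_indpt T"
    then show "enat (card T) \<le> enat (card S)"
      using assms steinitz[of T S] by auto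
  qed
  show "enat (card S) \<le> urk N"
    using assms by (intro urk_upper)
qed

text \<open>A finite supremum bounds the sizes, so some independent set has greatest size; any
  element outside its saturation could be adjoined to it.\<close>

lemma finite_urkE:
  assumes N: "N \<subseteq> carrier M" and fin: "urk N \<noteq> \<infinity>"
  obtains S where "finite S" "S \<subseteq> N" "lin_indpt S" "N \<subseteq> sat S"
proof -
  let ?P = "\<lambda>S. finite S \<and> S \<subseteq> N \<and> lin_indpt S"
  obtain n where n: "urk N = enat n"
    using fin by auto
  \<comment> \<open>The search for a greatest value asks for a strict bound, hence
    \<open>Suc n\<close>.\<close>
  have bound: "\<forall>S. ?P S \<longrightarrow> card S < Suc n"
    using urk_upper n by (metis enat_ord_simps(1) less_Suc_eq_le)
  have "?P {}"
    by (simp add: lin_indpt_empty)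
  from ex_has_greatest_nat[of ?P, OF this bound]
  obtain S where S: "?P S" and max: "\<And>T. ?P T \<Longrightarrow> card T \<le> card S"
    by metis
  have "x \<in> sat S" if x: "x \<in> N" for x
  proof (rule ccontr)
    assume nin: "x \<notin> sat S"
    then have "x \<notin> S"
      using subset_sat[of S] S N by blast
    moreover have "lin_indpt (insert x S)"
      using S N x nin by (intro lin_indpt_insert) auto
    ultimately show False
      using max[of "insert x S"] S x by simp
  qed
  then show ?thesis
    using that S by blast
qed

text \<open>An independent set can be enlarged by exactly the elements outside its saturation, by
  \<open>lin_indpt_insert\<close> and \<open>lin_dep_insert\<close>. This turns maximality into a
  spanning condition to which the Steinitz bound applies.\<close>

lemma max_lin_indpt_iff:
  "max_lin_indpt R M S \<longleftrightarrow> S \<subseteq> carrier M \<and> lin_indpt S \<and> carrier M \<subseteq> sat S"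
proof (intro iffI conjI)
  assume "max_lin_indpt R M S"
  then have S: "S \<subseteq> carrier M" "lin_indpt S"
    and max: "\<And>T. \<lbrakk>S \<subseteq> T; T \<subseteq> carrier M; lin_indpt T\<rbrakk> \<Longrightarrow> T = S"
    by (auto simp: max_lin_indpt_def maximal_def)
  show "S \<subseteq> carrier M" "lin_indpt S" by fact+
  show "carrier M \<subseteq> sat S"
  proof
    fix x assume x: "x \<in> carrier M"
    show "x \<in> sat S"
    proof (rule ccontr)
      assume "x \<notin> sat S"
      then have "insert x S = S"
        using S x by (intro max lin_indpt_insert) auto
      with \<open>x \<notin> sat S\<close> show False
        using subset_sat[OF S(1)] by blast
    qed
  qed
next
  assume S: "S \<subseteq> carrier M \<and> lin_indpt S \<and> carrier M \<subseteq> sat S"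
  have "T = S" if T: "S \<subseteq> T" "T \<subseteq> carrier M" "lin_indpt T" for T
  proof (rule ccontr)
    assume "T \<noteq> S"
    then obtain x where x: "x \<in> T" "x \<notin> S"
      using T by blast
    then have "lin_dep (insert x S)"
      using S T by (intro lin_dep_insert) auto
    then show False
      using T x supset_ld_is_ld[of "insert x S" T] by blast
  qed
  then show "max_lin_indpt R M S"
    using S by (auto simp: max_lin_indpt_def maximal_def)
qed

text \<open>All finite maximal independent sets have the same size by \<open>urk_eq_card\<close>, so
  the description in \<open>rk\<close> is well defined. If there are none,
  \<open>finite_urkE\<close> excludes a finite supremum.\<close>

lemma rk_eq_urk: "rk R M = urk (carrier M)"
proof (cases "\<exists>S. finite S \<and> max_lin_indpt R M S")
  case True
  have eq: "urk (carrier M) = enat (card S)" if "finite S" "max_lin_indpt R M S" for S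
    using that by (intro urk_eq_card) (auto simp: max_lin_indpt_iff)
  obtain S where S: "finite S" "max_lin_indpt R M S"
    using True by blast
  have "(THE n. \<exists>S. finite S \<and> max_lin_indpt R M S \<and> card S = n) = card S"
    using S eq by (intro the_equality) (auto, metis enat.inject)
  then show ?thesis
    using True eq[OF S] by (simp add: rk_def)
next
  case False
  then have "urk (carrier M) = \<infinity>"
    using finite_urkE[of "carrier M"] by (metis max_lin_indpt_iff order_refl)
  then show ?thesis
    using False by (auto simp: rk_def)
qed

section \<open>Homomorphisms out of a free cyclic submodule\<close>

lemma submodule_cyclic:
  assumes "x \<in> carrier M"
  shows "LinearCombinations.submodule R {c \<odot>\<^bsub>M\<^esub> x |c. c \<in> carrier R} M"
proof
  let ?C = "{c \<odot>\<^bsub>M\<^esub> x |c. c \<in> carrier R}"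
  show "?C \<subseteq> carrier M"
    using assms by auto
  show "\<zero>\<^bsub>M\<^esub> \<in> ?C"
    using assms by (auto intro!: exI[of _ \<zero>])
  fix y z c assume y: "y \<in> ?C"
  show "y \<oplus>\<^bsub>M\<^esub> z \<in> ?C" if "z \<in> ?C"
    using y that assms smult_l_distr[symmetric] by blast
  show "c \<odot>\<^bsub>M\<^esub> y \<in> ?C" if "c \<in> carrier R"
    using y that assms smult_assoc1[symmetric] by blast
qed

text \<open>The empty set spans only zero, so \<open>sat {}\<close> is the torsion submodule;
  outside it, \<open>x\<close> is annihilated by no nonzero \<open>c \<ominus> d\<close>.\<close>

lemma free_cancel:
  assumes x: "x \<in> carrier M" "x \<notin> sat {}" and c: "c \<in> carrier R" "d \<in> carrier R"
    and eq: "c \<odot>\<^bsub>M\<^esub> x = d \<odot>\<^bsub>M\<^esub> x"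
  shows "c = d"
proof -
  interpret S: LinearCombinations.submodule R "span {}" M
    by (rule span_is_submodule) simp
  have "(c \<ominus> d) \<odot>\<^bsub>M\<^esub> x = \<zero>\<^bsub>M\<^esub>"
    using x c eq by (simp add: R.minus_eq smult_l_distr smult_l_minus M.r_neg)
  then have "c \<ominus> d = \<zero>"
    using x c satI[of x "c \<ominus> d" "{}"] by auto
  then show ?thesis
    using c by (simp add: R.r_right_minus_eq)
qed

text \<open>An element that is not torsion generates a free module of rank one. Such modules are the
  test objects for pullbacks: homomorphisms out of them pick out elements.\<close>

lemma free_hom_exists:
  assumes x: "x \<in> carrier M" "x \<notin> sat {}" and N: "module R N" and y: "y \<in> carrier N"
  defines "C \<equiv> {c \<odot>\<^bsub>M\<^esub> x |c. c \<in> carrier R}"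
  obtains f where "f \<in> module_hom R (M\<lparr>carrier := C\<rparr>) N" "f \<in> extensional C" "f x = y"
proof -
  interpret N: module R N by fact
  interpret C: LinearCombinations.submodule R C M
    unfolding C_def using x by (intro submodule_cyclic)
  \<comment> \<open>The coefficient is unique by \<open>free_cancel\<close>. Restricting to
    \<open>C\<close> makes the function a morphism of \<open>Mod_cat\<close>.\<close>
  define f where "f = (\<lambda>t\<in>C. (THE c. c \<in> carrier R \<and> t = c \<odot>\<^bsub>M\<^esub> x) \<odot>\<^bsub>N\<^esub> y)"
  have f: "f (c \<odot>\<^bsub>M\<^esub> x) = c \<odot>\<^bsub>N\<^esub> y" if c: "c \<in> carrier R" for c
  proof -
    have "(THE d. d \<in> carrier R \<and> c \<odot>\<^bsub>M\<^esub> x = d \<odot>\<^bsub>M\<^esub> x) = c"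
      using c free_cancel[OF x] by (intro the_equality) auto
    then show ?thesis
      using c by (auto simp: f_def C_def)
  qed
  have "f \<in> module_hom R (M\<lparr>carrier := C\<rparr>) N"
    unfolding module_hom_def
  proof (simp, intro conjI allI impI)
    show "f \<in> C \<rightarrow> carrier N"
      using f y by (auto simp: C_def)
  next
    fix s t assume "s \<in> C \<and> t \<in> C"
    then obtain c d where "c \<in> carrier R" "s = c \<odot>\<^bsub>M\<^esub> x" "d \<in> carrier R" "t = d \<odot>\<^bsub>M\<^esub> x"
      by (auto simp: C_def)
    then show "f (s \<oplus>\<^bsub>M\<^esub> t) = f s \<oplus>\<^bsub>N\<^esub> f t"
      using f[of "c \<oplus> d"] x y by (simp add: f smult_l_distr N.smult_l_distr)
  next
    fix b t assume "b \<in> carrier R \<and> t \<in> C"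
    then obtain d where "b \<in> carrier R" "d \<in> carrier R" "t = d \<odot>\<^bsub>M\<^esub> x"
      by (auto simp: C_def)
    then show "f (b \<odot>\<^bsub>M\<^esub> t) = b \<odot>\<^bsub>N\<^esub> f t"
      using f[of "b \<otimes> d"] x y by (simp add: f smult_assoc1 N.smult_assoc1)
  qed
  moreover have "f x = y"
    using f[of \<one>] x y by simp
  moreover have "f \<in> extensional C"
    by (simp add: f_def)
  ultimately show ?thesis
    using that by blast
qed

lemma cyclic_hom_eqI:
  assumes x: "x \<in> carrier M"
  defines "C \<equiv> {c \<odot>\<^bsub>M\<^esub> x |c. c \<in> carrier R}"
  assumes f: "f \<in> module_hom R (M\<lparr>carrier := C\<rparr>) N" "f \<in> extensional C"
    and g: "g \<in> module_hom R (M\<lparr>carrier := C\<rparr>) N" "g \<in> extensional C"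
    and eq: "f x = g x"
  shows "f = g"
proof (rule extensionalityI[OF f(2) g(2)])
  fix t assume "t \<in> C"
  then obtain c where c: "c \<in> carrier R" "t = c \<odot>\<^bsub>M\<^esub> x"
    by (auto simp: C_def)
  have "x \<in> C"
    using x unfolding C_def by (auto intro!: exI[of _ \<one>])
  then show "f t = g t"
    using c eq module_hom_smult[OF f(1), of c x] module_hom_smult[OF g(1), of c x] by simp
qed

end

section \<open>Rank along homomorphisms: injectivity and additivity\<close>

locale domain_mod_hom = dom_M: domain_module R M + dom_N: domain_module R N + mod_hom R M N f
  for R (structure) and M (structure) and N (structure) and f
begin

lemma hom_smult: "\<lbrakk>c \<in> carrier R; x \<in> carrier M\<rbrakk> \<Longrightarrow> f (c \<odot>\<^bsub>M\<^esub> x) = c \<odot>\<^bsub>N\<^esub> f x"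
  using module_hom_smult[OF f_hom] .

lemma hom_add: "\<lbrakk>x \<in> carrier M; y \<in> carrier M\<rbrakk> \<Longrightarrow> f (x \<oplus>\<^bsub>M\<^esub> y) = f x \<oplus>\<^bsub>N\<^esub> f y"
  using module_hom_add[OF f_hom] .

text \<open>The preimage of the submodule \<open>sat Y\<close> is a submodule containing
  \<open>X\<close>, hence \<open>span X\<close>; the denominator of \<open>x\<close> passes through
  \<open>f\<close> and is cancelled in \<open>N\<close>.\<close>

lemma hom_sat:
  assumes X: "X \<subseteq> carrier M" and Y: "Y \<subseteq> carrier N"
    and x: "x \<in> dom_M.sat X" and sub: "f ` X \<subseteq> dom_N.sat Y"
  shows "f x \<in> dom_N.sat Y"
proof -
  interpret Y: LinearCombinations.submodule R "dom_N.sat Y" N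
    using Y by (rule dom_N.submodule_sat)
  let ?V = "{v \<in> carrier M. f v \<in> dom_N.sat Y}"
  have "LinearCombinations.submodule R ?V M"
    by unfold_locales (auto simp: hom_smult hom_add)
  then have "dom_M.span X \<subseteq> ?V"
    using X sub by (intro dom_M.span_is_subset) auto
  moreover obtain c where c: "x \<in> carrier M" "c \<in> carrier R" "c \<noteq> \<zero>" "c \<odot>\<^bsub>M\<^esub> x \<in> dom_M.span X"
    using x by (rule dom_M.satE)
  ultimately have "c \<odot>\<^bsub>N\<^esub> f x \<in> dom_N.sat Y"
    by (auto simp: hom_smult)
  then show ?thesis
    using c Y by (intro dom_N.sat_cancel[of Y "f x" c]) auto
qed

lemma span_image:
  assumes X: "X \<subseteq> carrier M"
  shows "dom_N.span (f ` X) \<subseteq> f ` dom_M.span X"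
proof -
  interpret X: LinearCombinations.submodule R "dom_M.span X" M
    using X by (rule dom_M.span_is_submodule)
  have cl: "v \<in> carrier M" if "v \<in> dom_M.span X" for v
    using X.subset that by blast
  have "LinearCombinations.submodule R (f ` dom_M.span X) N"
  proof
    show "f ` dom_M.span X \<subseteq> carrier N"
      using cl by auto
    show "\<zero>\<^bsub>N\<^esub> \<in> f ` dom_M.span X"
      using f0_is_0 X.zero_closed by (metis imageI)
  next
    fix v w assume "v \<in> f ` dom_M.span X" "w \<in> f ` dom_M.span X"
    then obtain v' w' where "v' \<in> dom_M.span X" "v = f v'" "w' \<in> dom_M.span X" "w = f w'"
      by blast
    then show "v \<oplus>\<^bsub>N\<^esub> w \<in> f ` dom_M.span X"
      by (intro image_eqI[of _ _ "v' \<oplus>\<^bsub>M\<^esub> w'"]) (simp_all add: cl hom_add X.m_closed)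
  next
    fix c v assume "c \<in> carrier R" "v \<in> f ` dom_M.span X"
    then obtain v' where "c \<in> carrier R" "v' \<in> dom_M.span X" "v = f v'"
      by blast
    then show "c \<odot>\<^bsub>N\<^esub> v \<in> f ` dom_M.span X"
      by (intro image_eqI[of _ _ "c \<odot>\<^bsub>M\<^esub> v'"]) (simp_all add: cl hom_smult X.smult_closed)
  qed
  then show ?thesis
    using dom_M.in_own_span[OF X] by (intro dom_N.span_is_subset) auto
qed

text \<open>Independent sets are carried over by \<open>lin_indpt_image\<close>, along
  \<open>f\<close> in one direction and along its inverse on \<open>K\<close> in the other. Each
  time it has to be checked that membership in saturations is reflected.\<close>

lemma urk_image:
  assumes K: "LinearCombinations.submodule R K M" and inj: "inj_on f K"
  shows "dom_N.urk (f ` K) = dom_M.urk K"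
proof -
  interpret K: LinearCombinations.submodule R K M by fact
  have KM: "x \<in> carrier M" if "x \<in> K" for x
    using K.subset that by blast
  show ?thesis
  proof (rule antisym)
    show "dom_M.urk K \<le> dom_N.urk (f ` K)"
    proof (rule dom_M.urk_least)
      fix S assume S: "finite S" "S \<subseteq> K" "dom_M.lin_indpt S"
      have "x \<in> dom_M.sat X" if X: "X \<subseteq> S" and x: "x \<in> S" and fx: "f x \<in> dom_N.sat (f ` X)" for X x
      proof -
        have XK: "X \<subseteq> K"
          using X S by blast
        obtain c where c: "c \<in> carrier R" "c \<noteq> \<zero>" "c \<odot>\<^bsub>N\<^esub> f x \<in> dom_N.span (f ` X)"
          using fx by (auto elim: dom_N.satE)
        then obtain z where z: "z \<in> dom_M.span X" "c \<odot>\<^bsub>N\<^esub> f x = f z"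
          using span_image[of X] XK K.subset by blast
        have "z \<in> K" "x \<in> K"
          using z dom_M.span_is_subset[OF XK K] x S by blast+
        \<comment> \<open>Both sides lie in the submodule \<open>K\<close>, so injectivity on
          \<open>K\<close> is enough.\<close>
        then have "c \<odot>\<^bsub>M\<^esub> x = z"
          using z c by (intro inj_onD[OF inj]) (simp_all add: hom_smult KM K.smult_closed)
        then show ?thesis
          using c z \<open>x \<in> K\<close> by (intro dom_M.satI[of x c]) (auto simp: KM)
      qed
      then have "dom_N.lin_indpt (f ` S) \<and> card (f ` S) = card S"
        using S KM
        by (intro dom_N.lin_indpt_image[OF dom_M.domain_module_axioms]) auto
      then show "enat (card S) \<le> dom_N.urk (f ` K)"
        using dom_N.urk_upper[of "f ` S" "f ` K"] S by auto
    qed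
    show "dom_N.urk (f ` K) \<le> dom_M.urk K"
    proof (rule dom_N.urk_least)
      fix T assume T: "finite T" "T \<subseteq> f ` K" "dom_N.lin_indpt T"
      define g where "g = inv_into K f"
      have gK: "g t \<in> K" and fg: "f (g t) = t" if "t \<in> T" for t
        using that T by (auto simp: g_def inv_into_into f_inv_into_f)
      have TN: "T \<subseteq> carrier N"
        using T KM by auto
      have "x \<in> dom_N.sat X" if X: "X \<subseteq> T" and x: "x \<in> T" and gx: "g x \<in> dom_M.sat (g ` X)" for X x
      proof -
        have "f ` g ` X = X"
          using X fg by force
        moreover have "X \<subseteq> dom_N.sat X"
          using X TN by (intro dom_N.subset_sat) auto
        ultimately have "f (g x) \<in> dom_N.sat X"
          using X TN gx gK KM by (intro hom_sat[of "g ` X"]) auto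
        then show ?thesis
          using fg x by simp
      qed
      then have "dom_M.lin_indpt (g ` T) \<and> card (g ` T) = card T"
        using T TN KM gK
        by (intro dom_M.lin_indpt_image[OF dom_N.domain_module_axioms]) auto
      then show "enat (card T) \<le> dom_M.urk K"
        using dom_M.urk_upper[of "g ` T" K] T gK by auto
    qed
  qed
qed

lemma urk_ker_plus_image:
  assumes surj: "f ` carrier M = carrier N"
  shows "dom_M.urk (carrier M) = dom_M.urk ker + dom_N.urk (carrier N)"
proof -
  \<comment> \<open>A set-theoretic section, which need not be linear: saturations are compared only
    after applying the linear map \<open>f\<close>.\<close>
  define g where "g = inv_into (carrier M) f"
  have gM: "g t \<in> carrier M" and fg: "f (g t) = t" if "t \<in> carrier N" for t
    using that surj by (auto simp: g_def inv_into_into f_inv_into_f)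
  have kerM: "ker \<subseteq> carrier M"
    by (auto simp: ker_def)
  \<comment> \<open>Applying \<open>f\<close> kills \<open>S\<close> and sends the chosen lifts of
    \<open>X\<close> back to \<open>X\<close>, so membership of \<open>g x\<close> in the saturation
    upstairs forces \<open>x\<close> into \<open>sat X\<close> downstairs.\<close>
  have li: "dom_M.lin_indpt (S \<union> g ` T) \<and> card (S \<union> g ` T) = card S + card T"
    if S: "finite S" "S \<subseteq> ker" "dom_M.lin_indpt S"
      and T: "finite T" "T \<subseteq> carrier N" "dom_N.lin_indpt T" for S T
  proof (rule dom_M.lin_indpt_Un_image[OF dom_N.domain_module_axioms])
    fix X x assume X: "X \<subseteq> T" and x: "x \<in> T" and gx: "g x \<in> dom_M.sat (S \<union> g ` X)"
    have XN: "X \<subseteq> carrier N"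
      using X T by blast
    interpret X: LinearCombinations.submodule R "dom_N.sat X" N
      using XN by (rule dom_N.submodule_sat)
    have "f ` g ` X = X"
      using XN fg by force
    then have "f ` (S \<union> g ` X) \<subseteq> dom_N.sat X"
      using S dom_N.subset_sat[OF XN] f_ker by (auto simp: image_Un)
    then have "f (g x) \<in> dom_N.sat X"
      using XN gx gM S kerM by (intro hom_sat[of "S \<union> g ` X"]) auto
    then show "x \<in> dom_N.sat X"
      using fg x T by auto
  qed (use S T gM kerM in auto)
  show ?thesis
  proof (cases "dom_M.urk ker = \<infinity> \<or> dom_N.urk (carrier N) = \<infinity>")
    case True
    \<comment> \<open>Each summand is at most the rank of \<open>M\<close>: independent subsets of
      the kernel are independent in \<open>M\<close>, and those of \<open>N\<close> lift along
      \<open>g\<close>. Hence if one summand is infinite, so are both sides.\<close>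
    have "dom_M.urk ker \<le> dom_M.urk (carrier M)"
      using kerM by (intro dom_M.urk_least dom_M.urk_upper) auto
    moreover have "dom_N.urk (carrier N) \<le> dom_M.urk (carrier M)"
    proof (rule dom_N.urk_least)
      fix T assume T: "finite T" "T \<subseteq> carrier N" "dom_N.lin_indpt T"
      then show "enat (card T) \<le> dom_M.urk (carrier M)"
        using li[of "{}" T] dom_M.lin_indpt_empty dom_M.urk_upper[of "g ` T" "carrier M"] gM by auto
    qed
    ultimately show ?thesis
      using True by auto
  next
    case False
    obtain S where S: "finite S" "S \<subseteq> ker" "dom_M.lin_indpt S" "ker \<subseteq> dom_M.sat S"
      by (rule dom_M.finite_urkE[OF kerM]) (use False in auto)
    obtain T where T: "finite T" "T \<subseteq> carrier N" "dom_N.lin_indpt T" "carrier N \<subseteq> dom_N.sat T"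
      by (rule dom_N.finite_urkE[OF order_refl]) (use False in auto)
    let ?U = "S \<union> g ` T"
    have U: "?U \<subseteq> carrier M"
      using S T kerM gM by auto
    interpret U: LinearCombinations.submodule R "dom_M.sat ?U" M
      using U by (rule dom_M.submodule_sat)
    have span: "x \<in> dom_M.sat ?U" if x: "x \<in> carrier M" for x
    proof -
      obtain c where c: "c \<in> carrier R" "c \<noteq> \<zero>" "c \<odot>\<^bsub>N\<^esub> f x \<in> dom_N.span T"
        using x T by (auto elim!: dom_N.satE)
      have "f ` g ` T = T"
        using T(2) fg by force
      moreover have "g ` T \<subseteq> carrier M"
        using U by blast
      ultimately have "dom_N.span T \<subseteq> f ` dom_M.span (g ` T)"
        using span_image[of "g ` T"] by simp
      then obtain z where z: "z \<in> dom_M.span (g ` T)" "c \<odot>\<^bsub>N\<^esub> f x = f z"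
        using c(3) by (meson imageE subsetD)
      have zU: "z \<in> dom_M.sat ?U"
        using z(1) dom_M.span_is_monotone[of "g ` T" ?U] dom_M.span_subset_sat[OF U] by blast
      then have zM: "z \<in> carrier M"
        using U.subset by blast
      \<comment> \<open>The multiple \<open>c\<close> of \<open>x\<close> has the same image as
        \<open>z\<close>, which lies in the span of the lifts. The difference is therefore covered
        by \<open>S\<close>; adding \<open>z\<close> back and cancelling \<open>c\<close> yields
        \<open>x\<close>.\<close>
      have "c \<odot>\<^bsub>M\<^esub> x \<ominus>\<^bsub>M\<^esub> z \<in> ker"
        using z c x zM by (simp add: ker_def hom_smult dom_N.M.minus_eq dom_N.M.r_neg)
      then have "c \<odot>\<^bsub>M\<^esub> x \<ominus>\<^bsub>M\<^esub> z \<in> dom_M.sat ?U"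
        using S dom_M.sat_mono[of S ?U] by blast
      then have "(c \<odot>\<^bsub>M\<^esub> x \<ominus>\<^bsub>M\<^esub> z) \<oplus>\<^bsub>M\<^esub> z \<in> dom_M.sat ?U"
        using zU by blast
      moreover have "(c \<odot>\<^bsub>M\<^esub> x \<ominus>\<^bsub>M\<^esub> z) \<oplus>\<^bsub>M\<^esub> z = c \<odot>\<^bsub>M\<^esub> x"
        using c x zM by (simp add: dom_M.M.minus_eq dom_M.M.a_assoc dom_M.M.l_neg)
      ultimately show ?thesis
        using c x U by (intro dom_M.sat_cancel[of ?U x c]) auto
    qed
    have "dom_M.urk (carrier M) = enat (card ?U)"
      using U S T li[of S T] span by (intro dom_M.urk_eq_card) auto
    moreover have "dom_M.urk ker = enat (card S)"
      using S kerM by (intro dom_M.urk_eq_card) auto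
    moreover have "dom_N.urk (carrier N) = enat (card T)"
      using T by (intro dom_N.urk_eq_card) auto
    ultimately show ?thesis
      using S T li[of S T] by simp
  qed
qed

end

section \<open>The category of modules and isomorphism invariance\<close>

lemma domain_module_intro: "\<lbrakk>domain R; module R M\<rbrakk> \<Longrightarrow> domain_module R M"
  by (simp add: domain_module_def)

lemma domain_mod_hom_intro:
  "\<lbrakk>domain R; module R M; module R N; f \<in> module_hom R M N\<rbrakk> \<Longrightarrow> domain_mod_hom R M N f"
  by (simp add: domain_mod_hom_def domain_module_def mod_hom_def mod_hom_axioms_def)

lemma Mod_cat_simps [simp]:
  "Obj (Mod_cat R) = {M. module R M}"
  "Hom (Mod_cat R) A B = module_hom R A B \<inter> extensional (carrier A)"
  "Ident (Mod_cat R) A = (\<lambda>x\<in>carrier A. x)"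
  "Comp (Mod_cat R) A B C g f = compose (carrier A) g f"
  by (simp_all add: Mod_cat_def)

lemma module_hom_compose:
  assumes A: "module R A" and f: "f \<in> module_hom R A B" and g: "g \<in> module_hom R B C"
  shows "compose (carrier A) g f \<in> module_hom R A C"
proof -
  interpret A: module R A by fact
  have cl: "f x \<in> carrier B" if "x \<in> carrier A" for x
    using module_hom_closed[OF f] that by blast
  show ?thesis
    using module_hom_closed[OF g]
    by (auto simp: module_hom_def compose_def cl module_hom_add[OF f] module_hom_add[OF g]
        module_hom_smult[OF f] module_hom_smult[OF g])
qed

text \<open>The identity laws hold as equalities of functions because morphisms are extensional on
  their source.\<close>

lemma category_Mod_cat:
  fixes R :: "('a, 'r) ring_scheme"
  shows "category (Mod_cat R :: (('a, 'm) module, 'm \<Rightarrow> 'm) cat)"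
proof
  fix A :: "('a, 'm) module"
  assume "A \<in> Obj (Mod_cat R)"
  then interpret A: module R A by simp
  show "Ident (Mod_cat R) A \<in> Hom (Mod_cat R) A A"
    by (simp add: module_hom_def)
next
  fix A B C :: "('a, 'm) module" and f g
  assume "A \<in> Obj (Mod_cat R)" "f \<in> Hom (Mod_cat R) A B" "g \<in> Hom (Mod_cat R) B C"
  then show "Comp (Mod_cat R) A B C g f \<in> Hom (Mod_cat R) A C"
    by (auto intro: module_hom_compose)
next
  fix A B :: "('a, 'm) module" and f
  assume "f \<in> Hom (Mod_cat R) A B"
  then have f: "f \<in> carrier A \<rightarrow> carrier B" "f \<in> extensional (carrier A)"
    by (auto dest: module_hom_closed)
  show "Comp (Mod_cat R) A A B f (Ident (Mod_cat R) A) = f"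
    using f by (simp add: compose_Id)
  show "Comp (Mod_cat R) A B B (Ident (Mod_cat R) B) f = f"
    using f by (simp add: Id_compose)
next
  fix A B C D :: "('a, 'm) module" and f g h
  assume "f \<in> Hom (Mod_cat R) A B"
  then have "f \<in> carrier A \<rightarrow> carrier B"
    by (auto dest: module_hom_closed)
  then show "Comp (Mod_cat R) A C D h (Comp (Mod_cat R) A B C g f) =
      Comp (Mod_cat R) A B D (Comp (Mod_cat R) B C D h g) f"
    by (simp add: compose_assoc)
qed

lemma rk_isomorphic:
  assumes R: "domain R" and A: "module R A" and B: "module R B"
    and iso: "isomorphic (Mod_cat R) A B"
  shows "rk R A = rk R B"
proof -
  obtain f g where f: "f \<in> module_hom R A B" and g: "g \<in> module_hom R B A"
    and gf: "compose (carrier A) g f = (\<lambda>x\<in>carrier A. x)"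
    and fg: "compose (carrier B) f g = (\<lambda>x\<in>carrier B. x)"
    using iso by (auto simp: isomorphic_def)
  interpret f: domain_mod_hom R A B f
    by (intro domain_mod_hom_intro) fact+
  have gf': "g (f x) = x" if "x \<in> carrier A" for x
    using fun_cong[OF gf, of x] that by (simp add: compose_def)
  have fg': "f (g y) = y" if "y \<in> carrier B" for y
    using fun_cong[OF fg, of y] that by (simp add: compose_def)
  have "inj_on f (carrier A)"
    using gf' by (rule inj_on_inverseI)
  moreover have "f ` carrier A = carrier B"
  proof (intro equalityI subsetI)
    fix y assume "y \<in> carrier B"
    then show "y \<in> f ` carrier A"
      using fg'[of y] module_hom_closed[OF g] by (intro image_eqI[of _ _ "g y"]) auto
  qed auto
  ultimately show ?thesis
    using f.urk_image[OF f.dom_M.submodule_carrier] by (simp add: f.dom_M.rk_eq_urk f.dom_N.rk_eq_urk)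
qed

section \<open>Pullbacks and the dimension formula\<close>

text \<open>
  The pullback is only tested against modules in the universe \<open>'m\<close>. If \<open>'m\<close> contains a free module
  of rank one, then mapping out of it shows that the underlying set of the pullback is the expected
  one; otherwise every module in the universe is torsion.
\<close>

lemma pullback_element:
  fixes A B C P M :: "('a, 'm) module"
  assumes R: "domain R" and A: "module R A" and B: "module R B" and C: "module R C"
    and pb: "is_pullback (Mod_cat R) A B C r f P p q"
    and M: "module R M" and x: "x \<in> carrier M" "x \<notin> domain_module.sat R M {}"
    and a: "a \<in> carrier A" and c: "c \<in> carrier C" and eq: "r a = f c"
  shows "\<exists>!w. w \<in> carrier P \<and> p w = a \<and> q w = c"
proof -
  interpret M: domain_module R M
    using R M by (rule domain_module_intro)
  \<comment> \<open>\<open>T\<close> is free on \<open>x\<close>, so evaluation at \<open>x\<close>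
    identifies the morphisms from \<open>T\<close> to \<open>N\<close> with the elements of
    \<open>N\<close>: \<open>free\<close> is surjectivity of this evaluation and \<open>eqI\<close>
    its injectivity.\<close>
  define T where "T = M\<lparr>carrier := {c \<odot>\<^bsub>M\<^esub> x |c. c \<in> carrier R}\<rparr>"
  have T: "module R T"
    unfolding T_def using M.submodule_cyclic[OF x(1)] by (rule M.submodule_is_module)
  have xT: "x \<in> carrier T"
    using x(1) by (auto simp: T_def intro!: exI[of _ "\<one>\<^bsub>R\<^esub>"])
  have free: "\<exists>h \<in> module_hom R T N \<inter> extensional (carrier T). h x = y"
    if N: "module R N" and y: "y \<in> carrier N" for N :: "('a, 'm) module" and y
    using M.free_hom_exists[OF x N y] by (simp add: T_def) blast
  have eqI: "h = k"
    if "h \<in> module_hom R T N \<inter> extensional (carrier T)"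
      "k \<in> module_hom R T N \<inter> extensional (carrier T)" "h x = k x"
    for h k and N :: "('a, 'm) module"
    using that by (intro M.cyclic_hom_eqI[OF x(1), of h N k]) (simp_all add: T_def)
  have hom_comp: "compose (carrier T) k h \<in> module_hom R T N' \<inter> extensional (carrier T)"
    if "h \<in> module_hom R T N \<inter> extensional (carrier T)" "k \<in> module_hom R N N'"
    for h k and N N' :: "('a, 'm) module"
    using module_hom_compose[OF T] that by auto
  have comp_x: "compose (carrier T) k h x = k (h x)" for k :: "'m \<Rightarrow> 'm" and h
    using xT by (rule compose_eq)
  have P: "module R P" and r: "r \<in> module_hom R A B" and f: "f \<in> module_hom R C B"
    and p: "p \<in> module_hom R P A" and q: "q \<in> module_hom R P C"
    using pb by (simp_all add: is_pullback_def)
  have univ: "\<forall>T \<in> {M :: ('a, 'm) module. module R M}. \<forall>\<alpha> \<in> module_hom R T A \<inter> extensional (carrier T).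
      \<forall>\<gamma> \<in> module_hom R T C \<inter> extensional (carrier T).
      compose (carrier T) r \<alpha> = compose (carrier T) f \<gamma> \<longrightarrow>
      (\<exists>!u. u \<in> module_hom R T P \<inter> extensional (carrier T) \<and>
        compose (carrier T) p u = \<alpha> \<and> compose (carrier T) q u = \<gamma>)"
    using pb unfolding is_pullback_def Mod_cat_simps by (elim conjE) assumption
  obtain \<alpha> where \<alpha>: "\<alpha> \<in> module_hom R T A \<inter> extensional (carrier T)" "\<alpha> x = a"
    using free[OF A a] by blast
  obtain \<gamma> where \<gamma>: "\<gamma> \<in> module_hom R T C \<inter> extensional (carrier T)" "\<gamma> x = c"
    using free[OF C c] by blast
  \<comment> \<open>It suffices to compare values at the generator, which are \<open>r a\<close> and
    \<open>f c\<close>.\<close>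
  have "compose (carrier T) r \<alpha> = compose (carrier T) f \<gamma>"
    by (rule eqI[OF hom_comp[OF \<alpha>(1) r] hom_comp[OF \<gamma>(1) f]]) (simp add: comp_x \<alpha> \<gamma> eq)
  with univ T \<alpha>(1) \<gamma>(1)
  have "\<exists>!u. u \<in> module_hom R T P \<inter> extensional (carrier T) \<and>
      compose (carrier T) p u = \<alpha> \<and> compose (carrier T) q u = \<gamma>"
    by (auto simp only: mem_Collect_eq Ball_def)
  then obtain u where u: "u \<in> module_hom R T P" "compose (carrier T) p u = \<alpha>"
      "compose (carrier T) q u = \<gamma>"
    and uniq: "\<And>v. \<lbrakk>v \<in> module_hom R T P \<inter> extensional (carrier T);
      compose (carrier T) p v = \<alpha>; compose (carrier T) q v = \<gamma>\<rbrakk> \<Longrightarrow> v = u"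
    by (elim ex1E) blast
  show ?thesis
  proof (intro ex1I conjI)
    show "u x \<in> carrier P"
      using module_hom_closed[OF u(1)] xT by auto
    show "p (u x) = a"
      using u(2) \<alpha>(2) comp_x by metis
    show "q (u x) = c"
      using u(3) \<gamma>(2) comp_x by metis
  next
    \<comment> \<open>A competing \<open>w\<close> is the value at \<open>x\<close> of some morphism
      \<open>v\<close> that has the same two composites as \<open>u\<close>, so
      \<open>v = u\<close>.\<close>
    fix w assume w: "w \<in> carrier P \<and> p w = a \<and> q w = c"
    then obtain v where v: "v \<in> module_hom R T P \<inter> extensional (carrier T)" "v x = w"
      using free[OF P] by blast
    have "compose (carrier T) p v = \<alpha>"
      by (rule eqI[OF hom_comp[OF v(1) p] \<alpha>(1)]) (simp add: comp_x \<alpha> v w)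
    moreover have "compose (carrier T) q v = \<gamma>"
      by (rule eqI[OF hom_comp[OF v(1) q] \<gamma>(1)]) (simp add: comp_x \<gamma> v w)
    ultimately show "w = u x"
      using uniq[OF v(1)] v(2) by simp
  qed
qed

lemma rk_pullback:
  fixes A B C P :: "('a, 'm) module"
  assumes R: "domain R" and A: "module R A" and B: "module R B" and C: "module R C"
    and retr: "is_retraction (Mod_cat R) A B r"
    and pb: "is_pullback (Mod_cat R) A B C r f P p q"
  shows "rk R P + rk R B = rk R A + rk R C"
proof (cases "\<exists>M :: ('a, 'm) module. module R M \<and> \<not> carrier M \<subseteq> domain_module.sat R M {}")
  case True
  then obtain M :: "('a, 'm) module" and x
    where M: "module R M" "x \<in> carrier M" "x \<notin> domain_module.sat R M {}"
    by blast
  have P: "module R P" and r: "r \<in> module_hom R A B" and f: "f \<in> module_hom R C B"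
    and p: "p \<in> module_hom R P A" and q: "q \<in> module_hom R P C"
    and comm: "compose (carrier P) r p = compose (carrier P) f q"
    using pb by (simp_all add: is_pullback_def)
  obtain s where s: "s \<in> module_hom R B A" "compose (carrier B) r s = (\<lambda>y\<in>carrier B. y)"
    using retr by (auto simp: is_retraction_def)
  interpret r: domain_mod_hom R A B r by (intro domain_mod_hom_intro) fact+
  interpret f: domain_mod_hom R C B f by (intro domain_mod_hom_intro) fact+
  interpret p: domain_mod_hom R P A p by (intro domain_mod_hom_intro) fact+
  interpret q: domain_mod_hom R P C q by (intro domain_mod_hom_intro) fact+
  note elem = pullback_element[OF R A B C pb M]
  have comm': "r (p w) = f (q w)" if "w \<in> carrier P" for w
    using fun_cong[OF comm, of w] that by (simp add: compose_def)
  have sA: "s y \<in> carrier A" and rs: "r (s y) = y" if "y \<in> carrier B" for y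
    using module_hom_closed[OF s(1)] fun_cong[OF s(2), of y] that by (auto simp: compose_def)
  have r_surj: "r ` carrier A = carrier B"
  proof (intro equalityI subsetI)
    fix y assume "y \<in> carrier B"
    then show "y \<in> r ` carrier A"
      using sA rs by (intro image_eqI[of _ _ "s y"]) auto
  qed auto
  have q_surj: "q ` carrier P = carrier C"
  proof (intro equalityI subsetI)
    fix c assume c: "c \<in> carrier C"
    \<comment> \<open>The section \<open>s\<close> of \<open>r\<close> makes \<open>s (f c)\<close>
      and \<open>c\<close> a compatible pair over \<open>B\<close>.\<close>
    then have "\<exists>!w. w \<in> carrier P \<and> p w = s (f c) \<and> q w = c"
      by (intro elem) (auto simp: sA rs)
    then show "c \<in> q ` carrier P"
      by blast
  qed auto
  have "inj_on p q.ker"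
  proof (rule inj_onI)
    fix v w assume v: "v \<in> q.ker" and w: "w \<in> q.ker" and eq: "p v = p w"
    \<comment> \<open>An element of \<open>P\<close> is determined by its two projections; on the
      kernel of \<open>q\<close> the second one is zero, which leaves \<open>p\<close>.\<close>
    have "\<exists>!u. u \<in> carrier P \<and> p u = p w \<and> q u = q w"
      using w comm' by (intro elem) (auto simp: q.ker_def)
    moreover have "q v = q w" "v \<in> carrier P" "w \<in> carrier P"
      using v w by (auto simp: q.ker_def)
    ultimately show "v = w"
      using eq by blast
  qed
  moreover have "p ` q.ker = r.ker"
  proof (intro equalityI subsetI)
    fix a assume "a \<in> p ` q.ker"
    then show "a \<in> r.ker"
      using comm' by (auto simp: q.ker_def r.ker_def)
  next
    fix a assume a: "a \<in> r.ker"
    \<comment> \<open>Since \<open>r a\<close> is zero, \<open>a\<close> is compatible with the zero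
      of \<open>C\<close>.\<close>
    then have "\<exists>!w. w \<in> carrier P \<and> p w = a \<and> q w = \<zero>\<^bsub>C\<^esub>"
      by (intro elem) (auto simp: r.ker_def)
    then show "a \<in> p ` q.ker"
      by (auto simp: q.ker_def)
  qed
  ultimately have "r.dom_M.urk r.ker = p.dom_M.urk q.ker"
    using p.urk_image[OF q.ker_is_submodule] by simp
  \<comment> \<open>Substituting both rank formulas leaves the same three summands on each side.
    Nothing is subtracted, so infinite ranks cause no trouble.\<close>
  then show ?thesis
    using r.urk_ker_plus_image[OF r_surj] q.urk_ker_plus_image[OF q_surj]
    by (simp add: r.dom_M.rk_eq_urk r.dom_N.rk_eq_urk p.dom_M.rk_eq_urk f.dom_M.rk_eq_urk add_ac)
next
  case False
  \<comment> \<open>In a torsion module the empty set is already a maximal independent set. The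
    dimension formula then only involves zeros.\<close>
  have "rk R M = 0" if M: "module R M" for M :: "('a, 'm) module"
  proof -
    interpret M: domain_module R M
      using R M by (rule domain_module_intro)
    have "M.urk (carrier M) = enat (card ({} :: 'm set))"
      using False M M.lin_indpt_empty by (intro M.urk_eq_card) auto
    then show ?thesis
      by (simp add: M.rk_eq_urk zero_enat_def)
  qed
  moreover have "module R P"
    using pb by (simp add: is_pullback_def)
  ultimately show ?thesis
    using A B C by simp
qed

theorem proposition7p6:
  fixes R :: "('a, 'r) ring_scheme"
  assumes "principal_domain R"
  shows "valued_dimension (Mod_cat R :: (('a, 'm) module, 'm \<Rightarrow> 'm) cat) (rk R)"
proof -
  interpret R: principal_domain R by fact
  interpret category "Mod_cat R :: (('a, 'm) module, 'm \<Rightarrow> 'm) cat"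
    by (rule category_Mod_cat)
  show ?thesis
    by unfold_locales (auto intro: rk_isomorphic rk_pullback R.domain_axioms)
qed

end
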